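(* Let $n \geq 4$. Then $h_3(n,\{(4,0),(4,2),(4,3)\}) = n-1$, and $$h_3(n,\{(4,0),(4,1),(4,3)\}) = \begin{cases} \frac{n}{2} & \text{if } n \equiv 0 \pmod 6,\\ \left\lceil \frac{n+1}{2}\right\rceil & \text{if } n\not\equiv 0 \pmod 6.\end{cases}$$
   Context: A $3$-graph is a pair $H=(V,E)$ with $E\subseteq\binom{V}{3}$. A homogeneous set in $H$ is a set of vertices that is either a clique (all triples inside are edges) or a coclique (no triple inside is an edge); $h(H)$ is the size of a largest homogeneous set. For a set $Q$ of pairs $(4,f)$, a $3$-graph $H$ is $Q$-free if for every $(4,f)\in Q$, no $4$-vertex subset of $V(H)$ spans exactly $f$ edges of $H$. $h_3(n,Q)$ denotes the minimum of $h(H)$ over all $n$-vertex $Q$-free $3$-graphs $H$. *)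

theory Defs
  imports Complex_Main "HOL-Library.Ramsey"
begin

definition three_graph :: "'a set \<Rightarrow> 'a set set \<Rightarrow> bool" where
  "three_graph V E \<longleftrightarrow> finite V \<and> E \<subseteq> [V]\<^bsup>3\<^esup>"

definition homogeneous :: "'a set \<Rightarrow> 'a set set \<Rightarrow> 'a set \<Rightarrow> bool" where
  "homogeneous V E S \<longleftrightarrow> S \<subseteq> V \<and> ([S]\<^bsup>3\<^esup> \<subseteq> E \<or> [S]\<^bsup>3\<^esup> \<inter> E = {})"

definition hom_number :: "'a set \<Rightarrow> 'a set set \<Rightarrow> nat" where
  "hom_number V E = Max {card S | S. homogeneous V E S}"

definition Q_free :: "(nat \<times> nat) set \<Rightarrow> 'a set \<Rightarrow> 'a set set \<Rightarrow> bool" where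
  "Q_free Q V E \<longleftrightarrow> (\<forall>(m, f) \<in> Q. \<not> (\<exists>S \<in> [V]\<^bsup>m\<^esup>. card {e \<in> E. e \<subseteq> S} = f))"

text \<open>Vertices are taken from \<^typ>\<open>nat\<close>, which loses nothing up to isomorphism.
  The minimum is meaningful only if some \<open>Q\<close>-free 3-graph on \<open>n\<close> vertices exists; this is
  the case whenever \<open>Q\<close> contains no pair \<open>(m, m choose 3)\<close>, by the complete 3-graph.\<close>

definition h3 :: "nat \<Rightarrow> (nat \<times> nat) set \<Rightarrow> nat" where
  "h3 n Q = (LEAST k. \<exists>(V :: nat set) E. three_graph V E \<and> card V = n \<and> Q_free Q V E \<and>
      hom_number V E = k)"

end

theory Submission
  imports Defs
begin

text \<open>
  In the first case a non-edge lies in a four-set \<open>{v, a, b, c}\<close> whose only edge is \<open>{a, b, c}\<close>;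
  adding vertices one at a time, all triples avoiding \<open>v\<close> turn out to be edges.

  In the second case the non-edges form a two-graph. Fixing a vertex \<open>v\<close> and joining \<open>x\<close> to \<open>y\<close>
  when \<open>{v, x, y}\<close> is a non-edge gives a graph without triangles and induced \<open>2K\<^sub>2\<close>, in which a
  triple is a non-edge of the hypergraph iff it spans exactly one edge. A vertex of maximum
  degree shows that such a graph is either bipartite or contains a pentagon. In the latter case
  it is a blow-up of the pentagon plus isolated vertices, and averaging over ten cliques of the
  hypergraph gives the bound. Balanced blow-ups of the pentagon plus one isolated vertex are extremal.
\<close>

section \<open>Homogeneous sets and values of the extremal function\<close>

lemma hom_number_le:
  assumes "finite V" "\<And>S. homogeneous V E S \<Longrightarrow> card S \<le> k"
  shows "hom_number V E \<le> k"
proof -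
  have "{card S |S. homogeneous V E S} \<subseteq> {..k}"
    using assms(2) by auto
  then have "finite {card S |S. homogeneous V E S}"
    using finite_subset by blast
  moreover have "homogeneous V E {}"
    by (auto simp: homogeneous_def nsets_def)
  then have "{card S |S. homogeneous V E S} \<noteq> {}"
    by blast
  ultimately show ?thesis
    unfolding hom_number_def using assms(2) by (auto simp: Max_le_iff)
qed

lemma card_le_hom_number:
  assumes "finite V" "homogeneous V E S"
  shows "card S \<le> hom_number V E"
proof -
  have "{card S |S. homogeneous V E S} \<subseteq> {..card V}"
    using assms(1) by (auto simp: homogeneous_def intro: card_mono)
  then have "finite {card S |S. homogeneous V E S}"
    using finite_subset by blast
  then show ?thesis
    unfolding hom_number_def using assms(2) by (auto intro: Max_ge)
qed

text \<open>Splits an extremal value into an explicit hypergraph and a bound for all hypergraphs.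
  The explicit one also keeps \<open>LEAST\<close> from ranging over nothing.\<close>

lemma h3_eqI:
  fixes V :: "nat set"
  assumes "three_graph V E" "card V = n" "Q_free Q V E"
    and upper: "\<And>S. homogeneous V E S \<Longrightarrow> card S \<le> k"
    and lower: "\<And>(V :: nat set) E. three_graph V E \<Longrightarrow> card V = n \<Longrightarrow> Q_free Q V E \<Longrightarrow>
      \<exists>S. homogeneous V E S \<and> k \<le> card S"
  shows "h3 n Q = k"
  unfolding h3_def
proof (rule Least_equality)
  have ge: "k \<le> hom_number V' E'"
    if "three_graph V' E'" "card V' = n" "Q_free Q V' E'" for V' :: "nat set" and E'
    using lower[OF that] card_le_hom_number that(1) unfolding three_graph_def
    by (meson order_trans)
  have "hom_number V E \<le> k"
    using assms(1) upper by (intro hom_number_le) (auto simp: three_graph_def)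
  then show "\<exists>(V :: nat set) E. three_graph V E \<and> card V = n \<and> Q_free Q V E \<and> hom_number V E = k"
    using assms(1-3) ge by (intro exI[of _ V] exI[of _ E]) (auto intro: antisym)
  show "k \<le> l" if "\<exists>(V :: nat set) E. three_graph V E \<and> card V = n \<and> Q_free Q V E \<and> hom_number V E = l" for l
    using that ge by auto
qed

section \<open>Edge counts on four vertices\<close>

lemma three_subset_of_four:
  assumes "e \<subseteq> {a, b, c, d}" "card e = 3" "distinct [a, b, c, d]"
  shows "e \<in> {{a, b, c}, {a, b, d}, {a, c, d}, {b, c, d}}"
proof -
  have "card ({a, b, c, d} - e) = 1"
    using assms by (subst card_Diff_subset) (auto intro: finite_subset)
  then obtain x where x: "{a, b, c, d} - e = {x}"
    by (auto simp: card_1_singleton_iff)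
  then have "e = {a, b, c, d} - {x}" "x \<in> {a, b, c, d}"
    using assms(1) by auto
  then show ?thesis
    using assms(3) by auto
qed

lemma card_edges_of_four:
  assumes "E \<subseteq> [V]\<^bsup>3\<^esup>" "distinct [a, b, c, d]"
  shows "card {e \<in> E. e \<subseteq> {a, b, c, d}} =
    of_bool ({a, b, c} \<in> E) + of_bool ({a, b, d} \<in> E) + of_bool ({a, c, d} \<in> E) + of_bool ({b, c, d} \<in> E)"
proof -
  have "{e \<in> E. e \<subseteq> {a, b, c, d}} = {{a, b, c}, {a, b, d}, {a, c, d}, {b, c, d}} \<inter> E"
    using three_subset_of_four[OF _ _ assms(2)] assms(1) by (auto simp: nsets_def)
  moreover have "{a, b, c} \<noteq> {a, b, d}" "{a, b, c} \<noteq> {a, c, d}" "{a, b, c} \<noteq> {b, c, d}"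
    "{a, b, d} \<noteq> {a, c, d}" "{a, b, d} \<noteq> {b, c, d}" "{a, c, d} \<noteq> {b, c, d}"
    using assms(2) by auto
  ultimately show ?thesis
    by (auto simp: Int_insert_left)
qed

lemma ball_nsets_3_iff:
  "(\<forall>e \<in> [S]\<^bsup>3\<^esup>. P e) \<longleftrightarrow>
    (\<forall>a \<in> S. \<forall>b \<in> S. \<forall>c \<in> S. distinct [a, b, c] \<longrightarrow> P {a, b, c})"
proof
  show "\<forall>a \<in> S. \<forall>b \<in> S. \<forall>c \<in> S. distinct [a, b, c] \<longrightarrow> P {a, b, c}" if "\<forall>e \<in> [S]\<^bsup>3\<^esup>. P e"
    by (intro ballI impI bspec[OF that]) (simp add: nsets_def)
  show "\<forall>e \<in> [S]\<^bsup>3\<^esup>. P e"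
    if P: "\<forall>a \<in> S. \<forall>b \<in> S. \<forall>c \<in> S. distinct [a, b, c] \<longrightarrow> P {a, b, c}"
  proof
    fix e assume "e \<in> [S]\<^bsup>3\<^esup>"
    then obtain a b c where "{a, b, c} \<subseteq> S" "distinct [a, b, c]" "e = {a, b, c}"
      by (auto simp: nsets_def card_3_iff)
    then show "P e"
      using P by simp
  qed
qed

lemma ball_nsets_4_iff:
  "(\<forall>e \<in> [S]\<^bsup>4\<^esup>. P e) \<longleftrightarrow>
    (\<forall>a \<in> S. \<forall>b \<in> S. \<forall>c \<in> S. \<forall>d \<in> S. distinct [a, b, c, d] \<longrightarrow> P {a, b, c, d})"
proof
  show "\<forall>a \<in> S. \<forall>b \<in> S. \<forall>c \<in> S. \<forall>d \<in> S. distinct [a, b, c, d] \<longrightarrow> P {a, b, c, d}"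
    if "\<forall>e \<in> [S]\<^bsup>4\<^esup>. P e"
    by (intro ballI impI bspec[OF that]) (simp add: nsets_def)
  show "\<forall>e \<in> [S]\<^bsup>4\<^esup>. P e"
    if P: "\<forall>a \<in> S. \<forall>b \<in> S. \<forall>c \<in> S. \<forall>d \<in> S. distinct [a, b, c, d] \<longrightarrow> P {a, b, c, d}"
  proof
    fix e assume "e \<in> [S]\<^bsup>4\<^esup>"
    then obtain a b c d where abcd: "{a, b, c, d} \<subseteq> S" "b \<noteq> a" "c \<noteq> a" "c \<noteq> b" "d \<noteq> a" "d \<noteq> b" "d \<noteq> c"
      and e: "e = {a, b, c, d}"
      unfolding nsets_4_eq by fastforce
    from abcd have "distinct [a, b, c, d]"
      by auto
    then show "P e"
      using P abcd(1) unfolding e by simp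
  qed
qed

text \<open>Reduces freeness to four truth values per quadruple, so that arguments about a few named
  vertices become Boolean case splits.\<close>

lemma Q_free_four_iff:
  assumes "E \<subseteq> [V]\<^bsup>3\<^esup>"
  shows "Q_free {(4, p), (4, q), (4, r)} V E \<longleftrightarrow>
    (\<forall>a \<in> V. \<forall>b \<in> V. \<forall>c \<in> V. \<forall>d \<in> V. distinct [a, b, c, d] \<longrightarrow>
      of_bool ({a, b, c} \<in> E) + of_bool ({a, b, d} \<in> E) + of_bool ({a, c, d} \<in> E) + of_bool ({b, c, d} \<in> E)
      \<notin> {p, q, r})"
    (is "_ \<longleftrightarrow> ?R")
proof -
  have "Q_free {(4, p), (4, q), (4, r)} V E \<longleftrightarrow>
    (\<forall>S \<in> [V]\<^bsup>4\<^esup>. card {e \<in> E. e \<subseteq> S} \<notin> {p, q, r})"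
    unfolding Q_free_def by auto
  also have "\<dots> \<longleftrightarrow> (\<forall>a \<in> V. \<forall>b \<in> V. \<forall>c \<in> V. \<forall>d \<in> V. distinct [a, b, c, d] \<longrightarrow>
      card {e \<in> E. e \<subseteq> {a, b, c, d}} \<notin> {p, q, r})"
    by (rule ball_nsets_4_iff)
  also have "\<dots> \<longleftrightarrow> ?R"
    by (simp only: card_edges_of_four[OF assms] cong: ball_cong imp_cong)
  finally show ?thesis .
qed

lemma nsets3_subset_iff:
  "[S]\<^bsup>3\<^esup> \<subseteq> E \<longleftrightarrow> (\<forall>a \<in> S. \<forall>b \<in> S. \<forall>c \<in> S. distinct [a, b, c] \<longrightarrow> {a, b, c} \<in> E)"
  using ball_nsets_3_iff[of S "\<lambda>e. e \<in> E"] by (simp add: subset_iff Ball_def)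

section \<open>Hypergraphs whose four-sets span one or four edges\<close>

lemma large_clique_of_one_or_four:
  assumes G: "three_graph V E" and Q: "Q_free {(4, 0), (4, 2), (4, 3)} V E" and V: "card V \<ge> 4"
  shows "\<exists>S. homogeneous V E S \<and> card V - 1 \<le> card S"
proof (cases "[V]\<^bsup>3\<^esup> \<subseteq> E")
  case True
  then show ?thesis
    by (intro exI[of _ V]) (auto simp: homogeneous_def)
next
  case False
  define T where "T a b c \<longleftrightarrow> {a, b, c} \<in> E" for a b c
  have T_swap: "T a b c \<longleftrightarrow> T b a c" "T a b c \<longleftrightarrow> T a c b" for a b c
    unfolding T_def by (simp_all add: insert_commute)
  have quad: "of_bool (T a b c) + of_bool (T a b d) + of_bool (T a c d) + of_bool (T b c d)
      \<notin> {0, 2, 3 :: nat}"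
    if "{a, b, c, d} \<subseteq> V" "distinct [a, b, c, d]" for a b c d
    using Q that G unfolding T_def three_graph_def by (subst (asm) Q_free_four_iff) auto
  define star where "star v a b c \<longleftrightarrow> {v, a, b, c} \<subseteq> V \<and> distinct [v, a, b, c] \<and> T a b c \<and>
    \<not> T v a b \<and> \<not> T v a c \<and> \<not> T v b c" for v a b c
  have star_swap: "star v a b c \<Longrightarrow> star v b a c" "star v a b c \<Longrightarrow> star v a c b" for v a b c
    unfolding star_def using T_swap by auto
  \<comment> \<open>Exchange: any further vertex can take the place of \<open>c\<close>. Since
    \<open>{a, b, c}\<close> is an edge, the other three triples of \<open>{a, b, c, x}\<close> are
    all edges or all non-edges. In the latter case exactly one triple of each pair among
    \<open>{v, a, x}\<close>, \<open>{v, b, x}\<close>, \<open>{v, c, x}\<close> would be an edge,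
    which is impossible for three triples.\<close>
  have star_step: "star v a b x" if "star v a b c" "x \<in> V" "x \<notin> {v, a, b}" for v a b c x
  proof (cases "x = c")
    case False
    have known: "T a b c" "\<not> T v a b" "\<not> T v a c" "\<not> T v b c"
      using that(1) by (auto simp: star_def)
    have "of_bool (T a b c) + of_bool (T a b x) + of_bool (T a c x) + of_bool (T b c x) \<notin> {0, 2, 3 :: nat}"
      "of_bool (T v a b) + of_bool (T v a x) + of_bool (T v b x) + of_bool (T a b x) \<notin> {0, 2, 3 :: nat}"
      "of_bool (T v a c) + of_bool (T v a x) + of_bool (T v c x) + of_bool (T a c x) \<notin> {0, 2, 3 :: nat}"
      "of_bool (T v b c) + of_bool (T v b x) + of_bool (T v c x) + of_bool (T b c x) \<notin> {0, 2, 3 :: nat}"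
      using that False unfolding star_def by (intro quad; auto)+
    then have "T a b x \<and> \<not> T v a x \<and> \<not> T v b x"
      using known by (cases "T a b x"; cases "T a c x"; cases "T b c x"; cases "T v a x"; cases "T v b x";
        cases "T v c x"; simp)
    then show ?thesis
      using that unfolding star_def by auto
  qed (use that in auto)
  obtain p q r where pqr: "p \<in> V" "q \<in> V" "r \<in> V" "distinct [p, q, r]" "\<not> T p q r"
    using False unfolding nsets3_subset_iff T_def by blast
  then have "card {p, q, r} < card V"
    using V by simp
  then obtain s where s: "s \<in> V" "s \<notin> {p, q, r}"
    by (metis card_mono finite.emptyI finite_insert leD subsetI)
  \<comment> \<open>A four-set containing a non-edge spans exactly one edge; the vertex outside that
    edge is the centre.\<close>
  have "star p q r s \<or> star q p r s \<or> star r p q s \<or> star s p q r"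
    using quad[of p q r s] pqr s T_swap unfolding star_def by (auto split: if_splits simp: of_bool_def)
  then obtain v a b c where star: "star v a b c"
    by blast
  \<comment> \<open>Starting from one star at \<open>v\<close>, exchange its leaves one at a time
    until they are \<open>x\<close>, \<open>y\<close>, \<open>z\<close>.\<close>
  have edge: "T x y z" if "x \<in> V - {v}" "y \<in> V - {v}" "z \<in> V - {v}" "distinct [x, y, z]" for x y z
  proof -
    have "\<exists>p q. star v x p q"
      using star star_swap star_step[of v a b c x] that(1) by blast
    then obtain p q where "star v x p q"
      by blast
    then have "\<exists>q. star v x y q"
      using star_swap(2)[of v x p q] star_swap(2)[OF star_step[of v x p q y]] that
      by (cases "y = p") auto
    then obtain q where "star v x y q"
      by blast
    then have "star v x y z"
      using star_step that by auto
    then show ?thesis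
      unfolding star_def by blast
  qed
  have "homogeneous V E (V - {v})"
    using edge unfolding homogeneous_def nsets3_subset_iff T_def by blast
  moreover have "card (V - {v}) = card V - 1"
    using star by (simp add: star_def card_Diff_singleton)
  ultimately show ?thesis
    by (intro exI[of _ "V - {v}"]) simp
qed

text \<open>Extremal is the complete hypergraph with an isolated vertex \<open>0\<close> added: a
  four-set spans one edge if it contains \<open>0\<close>, and four otherwise.\<close>

lemma h3_one_or_four:
  assumes "n \<ge> 4"
  shows "h3 n {(4, 0), (4, 2), (4, 3)} = n - 1"
proof (rule h3_eqI)
  let ?V = "{..<n}"
  let ?E = "{e \<in> [?V]\<^bsup>3\<^esup>. 0 \<notin> e}"
  show "three_graph ?V ?E"
    by (auto simp: three_graph_def)
  have mem: "{a, b, c} \<in> ?E \<longleftrightarrow> 0 \<notin> {a, b, c}" if "{a, b, c} \<subseteq> ?V" "distinct [a, b, c]" for a b c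
    using that by (auto simp: nsets_def)
  show "Q_free {(4, 0), (4, 2), (4, 3)} ?V ?E"
    by (subst Q_free_four_iff) (use mem in auto)
  show "card S \<le> n - 1" if S: "homogeneous ?V ?E S" for S
  proof (rule ccontr)
    assume "\<not> card S \<le> n - 1"
    moreover have "S \<subseteq> ?V"
      using S by (simp add: homogeneous_def)
    ultimately have "S = ?V"
      by (intro card_subset_eq) (auto dest: card_mono[rotated])
    then have "[?V]\<^bsup>3\<^esup> \<subseteq> ?E \<or> [?V]\<^bsup>3\<^esup> \<inter> ?E = {}"
      using S by (simp add: homogeneous_def)
    moreover have "{0, 1, 2} \<in> [?V]\<^bsup>3\<^esup>" "{0, 1, 2} \<notin> ?E" "{1, 2, 3} \<in> [?V]\<^bsup>3\<^esup>" "{1, 2, 3} \<in> ?E"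
      using assms by (auto simp: nsets_def)
    ultimately show False
      by blast
  qed
  show "\<exists>S. homogeneous V E S \<and> n - 1 \<le> card S"
    if "three_graph V E" "card V = n" "Q_free {(4, 0), (4, 2), (4, 3)} V E" for V :: "nat set" and E
    using large_clique_of_one_or_four that assms by blast
qed simp

section \<open>Graphs without triangles and induced \<open>2K2\<close>\<close>

lemma card_Un3:
  assumes "finite A" "finite B" "finite C" "A \<inter> B = {}" "A \<inter> C = {}" "B \<inter> C = {}"
  shows "card (A \<union> B \<union> C) = card A + card B + card C"
  using assms by (simp add: card_Un_disjoint Int_Un_distrib2)

text \<open>Taking all vertices equal in \<open>triangle_free\<close> rules out loops. If the two
  edges in \<open>two_K2_free\<close> share an end, the conclusion holds by symmetry, so the axiom
  only concerns disjoint edges.\<close>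

locale triangle_2K2_free_graph =
  fixes W :: "'a set" and R :: "'a \<Rightarrow> 'a \<Rightarrow> bool"
  assumes finite_W: "finite W"
    and in_W: "R x y \<Longrightarrow> x \<in> W"
    and sym: "R x y \<Longrightarrow> R y x"
    and triangle_free: "R x y \<Longrightarrow> R y z \<Longrightarrow> \<not> R x z"
    and two_K2_free: "R x y \<Longrightarrow> R z w \<Longrightarrow> R x z \<or> R x w \<or> R y z \<or> R y w"
begin

text \<open>Both independent sets and complete bipartite pieces qualify: no triple spans exactly one edge.\<close>
definition bicomplete :: "'a set \<Rightarrow> bool" where
  "bicomplete S \<longleftrightarrow> S \<subseteq> W \<and> (\<forall>x \<in> S. \<forall>y \<in> S. \<forall>z \<in> S. R x y \<longrightarrow> R x z \<or> R y z)"

text \<open>A closed walk of length five; without triangles it is automatically an induced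
  5-cycle.\<close>

definition pentagon :: "'a \<Rightarrow> 'a \<Rightarrow> 'a \<Rightarrow> 'a \<Rightarrow> 'a \<Rightarrow> bool" where
  "pentagon a b c d e \<longleftrightarrow> R a b \<and> R b c \<and> R c d \<and> R d e \<and> R e a"

text \<open>For a pentagon \<open>a b c d e\<close>, the set \<open>common e b\<close> is the
  blow-up class of \<open>a\<close>, and likewise around the cycle.\<close>

definition common :: "'a \<Rightarrow> 'a \<Rightarrow> 'a set" where
  "common x y = {w. R w x \<and> R w y}"

definition isolated :: "'a set" where
  "isolated = {w \<in> W. \<forall>u. \<not> R w u}"

lemma in_W2: "R x y \<Longrightarrow> y \<in> W"
  using in_W sym by blast

lemma common_subset: "common x y \<subseteq> W"
  using in_W by (auto simp: common_def)

lemma finite_common: "finite (common x y)"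
  using common_subset finite_W finite_subset by blast

lemma finite_isolated: "finite isolated"
  using finite_W by (simp add: isolated_def)

lemma pentagon_rotate: "pentagon a b c d e \<Longrightarrow> pentagon b c d e a"
  by (auto simp: pentagon_def)

lemma pentagon_cover:
  assumes "pentagon a b c d e"
  shows "W = isolated \<union> common e b \<union> common a c \<union> common b d \<union> common c e \<union> common d a"
proof -
  have "w \<in> common e b \<or> w \<in> common a c \<or> w \<in> common b d \<or> w \<in> common c e \<or> w \<in> common d a"
    if "R w u" for w u
  proof -
    have hit: "R w x \<or> R w y \<or> R u x \<or> R u y" if "R x y" for x y
      using two_K2_free[OF \<open>R w u\<close> that] .
    have ind: "\<not> (R u x \<and> R u y)" if "R x y" for x y
      using triangle_free[of u x y] that by blast
    have edges: "R a b" "R b c" "R c d" "R d e" "R e a"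
      using assms by (auto simp: pentagon_def)
    \<comment> \<open>Otherwise \<open>u\<close> would have a neighbour on each of the five edges;
      but its neighbours on the cycle are independent, hence at most two, and touch at most four
      edges.\<close>
    have "R w a \<or> R w b \<or> R w c \<or> R w d \<or> R w e"
      using edges[THEN hit] edges[THEN ind] by argo
    \<comment> \<open>Compare the edge \<open>w a\<close> with the opposite edge \<open>c d\<close>:
      the chords \<open>a c\<close> and \<open>a d\<close> would close triangles.\<close>
    moreover have opp: "R w d \<or> R w c" if "R w a" "R a b" "R b c" "R c d" "R d e" "R e a" for a b c d e
      using two_K2_free[OF that(1,4)] triangle_free[OF that(2,3)] triangle_free[OF that(5,6)]
      by (blast dest: sym)
    note opp[OF _ edges] opp[OF _ edges(2-5,1)] opp[OF _ edges(3-5,1,2)] opp[OF _ edges(4,5,1-3)]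
      opp[OF _ edges(5,1-4)]
    ultimately show ?thesis
      unfolding common_def mem_Collect_eq by argo
  qed
  then have "W \<subseteq> isolated \<union> common e b \<union> common a c \<union> common b d \<union> common c e \<union> common d a"
    unfolding isolated_def by blast
  then show ?thesis
    using common_subset by (intro equalityI) (auto simp: isolated_def subset_iff)
qed

lemma pentagon_disjoint:
  assumes "pentagon a b c d e"
  shows "isolated \<inter> common e b = {}" "common e b \<inter> common a c = {}" "common e b \<inter> common b d = {}"
proof -
  have "R e a" "R d e"
    using assms by (auto simp: pentagon_def)
  then show "isolated \<inter> common e b = {}" "common e b \<inter> common a c = {}" "common e b \<inter> common b d = {}"
    using triangle_free unfolding common_def isolated_def by blast+
qed

lemma no_edge_if_common: "R x u \<Longrightarrow> R y u \<Longrightarrow> \<not> R x y"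
  using triangle_free sym by blast

lemma pentagon_no_edge:
  assumes "x \<in> common e b \<union> common b d" "y \<in> common e b \<union> common b d"
  shows "\<not> R x y"
  using assms by (intro no_edge_if_common[of x b y]) (auto simp: common_def)

text \<open>The edges \<open>x e\<close> and \<open>y c\<close> must be joined, and each connection
  other than \<open>x y\<close> would create a triangle. So classes of consecutive vertices are
  completely joined.\<close>

lemma pentagon_edge:
  assumes "pentagon a b c d e" "x \<in> common e b" "y \<in> common a c"
  shows "R x y"
proof -
  have R: "R a b" "R b c" "R c d" "R d e" "R e a" "R x e" "R x b" "R y a" "R y c"
    using assms by (auto simp: pentagon_def common_def)
  have "\<not> R x c" "\<not> R e y" "\<not> R e c"
    using triangle_free[OF R(7,2)] no_edge_if_common[OF R(5,8)] no_edge_if_common[OF sym[OF R(4)] R(3)]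
    by blast+
  then show ?thesis
    using two_K2_free[OF R(6,9)] by blast
qed

lemma bicomplete_independent:
  "bicomplete (isolated \<union> common e b \<union> common b d)"
proof -
  have "\<not> R x y" if "x \<in> isolated \<union> common e b \<union> common b d" "y \<in> isolated \<union> common e b \<union> common b d" for x y
    using that pentagon_no_edge[of x e b d y] sym[of x y] unfolding isolated_def by blast
  moreover have "isolated \<union> common e b \<union> common b d \<subseteq> W"
    using common_subset by (auto simp: isolated_def)
  ultimately show ?thesis
    unfolding bicomplete_def by blast
qed

lemma bicomplete_path:
  assumes "pentagon a b c d e"
  shows "bicomplete (common e b \<union> common a c \<union> common b d)"
proof -
  have cross: "R x y" if "x \<in> common e b \<union> common b d" "y \<in> common a c" for x y
    using pentagon_edge[OF assms] pentagon_edge[OF pentagon_rotate[OF assms]] that sym by blast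
  have ind: "\<not> R x y" if "x \<in> common a c" "y \<in> common a c" for x y
    using that by (intro no_edge_if_common[of x a y]) (auto simp: common_def)
  let ?S = "common e b \<union> common a c \<union> common b d"
  have "R x z \<or> R y z" if "x \<in> ?S" "y \<in> ?S" "z \<in> ?S" "R x y" for x y z
  proof (cases "z \<in> common a c")
    case True
    then have "x \<in> common e b \<union> common b d \<or> y \<in> common e b \<union> common b d"
      using ind[of x y] that by blast
    then show ?thesis
      using cross True by blast
  next
    case False
    then have "x \<in> common a c \<or> y \<in> common a c"
      using pentagon_no_edge[of x e b d y] that by blast
    then show ?thesis
      using cross[of z x] cross[of z y] False that(3) sym by blast
  qed
  moreover have "?S \<subseteq> W"
    using common_subset by auto
  ultimately show ?thesis
    unfolding bicomplete_def by blast
qed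

text \<open>The ten bicomplete unions of three classes cover every class five times, so their average
  size is half of the total; if none exceeds it, then all six classes have the same size.\<close>
lemma pentagon_large_bicomplete:
  assumes P: "pentagon a b c d e"
  shows "\<exists>S. bicomplete S \<and> (card W < 2 * card S \<or> 6 dvd card W \<and> card W = 2 * card S)"
proof (rule ccontr)
  assume "\<not> ?thesis"
  then have small: "2 * card S \<le> card W" "6 dvd card W \<Longrightarrow> 2 * card S \<noteq> card W" if "bicomplete S" for S
    using that by (auto simp: not_less)
  note P1 = pentagon_rotate[OF P]
  note P2 = pentagon_rotate[OF P1]
  note P3 = pentagon_rotate[OF P2]
  note P4 = pentagon_rotate[OF P3]
  note fin = finite_common finite_isolated
  have ind: "card (isolated \<union> common e b \<union> common b d) = card isolated + card (common e b) + card (common b d)"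
    and path: "card (common e b \<union> common a c \<union> common b d) = card (common e b) + card (common a c) + card (common b d)"
    if "pentagon a b c d e" for a b c d e
    using pentagon_disjoint[OF that] pentagon_disjoint[OF pentagon_rotate[OF that]]
      pentagon_disjoint[OF pentagon_rotate[OF pentagon_rotate[OF that]]]
    by (simp_all add: card_Un3 fin)
  note disj = pentagon_disjoint[OF P] pentagon_disjoint[OF P1] pentagon_disjoint[OF P2]
    pentagon_disjoint[OF P3] pentagon_disjoint[OF P4]
  have total: "card W = card isolated + card (common e b) + card (common a c) + card (common b d)
      + card (common c e) + card (common d a)"
    by (subst arg_cong[OF pentagon_cover[OF P], of card])
      (simp add: card_Un_disjoint fin Int_Un_distrib2 disj disj[THEN trans[OF Int_commute]])
  have *: "2 * (card isolated + card (common e b) + card (common b d)) \<le> card W"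
      "2 * (card (common e b) + card (common a c) + card (common b d)) \<le> card W"
    if "pentagon a b c d e" for a b c d e
    using small(1)[OF bicomplete_independent[of e b d]] small(1)[OF bicomplete_path[OF that]]
      ind[OF that] path[OF that] by simp_all
  note all = *[OF P] *[OF P1] *[OF P2] *[OF P3] *[OF P4] total
  \<comment> \<open>The independent set of classes \<open>a\<close>, \<open>c\<close> and the path
    of classes \<open>d\<close>, \<open>e\<close>, \<open>a\<close> together count the class of
    \<open>a\<close> twice, that of \<open>b\<close> never and all others once. Rotating gives a
    cycle of inequalities.\<close>
  have "card (common e b) \<le> card (common a c)"
    using all(1,8,11) by simp
  moreover have "card (common a c) \<le> card (common b d)"
    using all(3,10,11) by simp
  moreover have "card (common b d) \<le> card (common c e)"
    using all(5,2,11) by simp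
  moreover have "card (common c e) \<le> card (common d a)"
    using all(7,4,11) by simp
  moreover have "card (common d a) \<le> card (common e b)"
    using all(9,6,11) by simp
  ultimately have eqs: "card (common a c) = card (common e b)" "card (common b d) = card (common e b)"
    "card (common c e) = card (common e b)" "card (common d a) = card (common e b)"
    by linarith+
  \<comment> \<open>With five equal classes, the independent set bounds \<open>card isolated\<close>
    from above by their size and the path bounds it from below.\<close>
  then have six: "card W = 6 * card (common e b)" and half: "card W = 2 * (card isolated + card (common e b) + card (common b d))"
    using all(1,2,11) unfolding eqs by simp_all
  have "6 dvd card W"
    using six by (rule dvdI)
  then show False
    using small(2)[OF bicomplete_independent[of e b d]] ind[OF P] half by metis
qed

lemma large_bicomplete:
  assumes v: "v \<in> isolated"
  shows "\<exists>S. bicomplete S \<and> (card W < 2 * card S \<or> 6 dvd card W \<and> card W = 2 * card S)"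
proof (cases "\<exists>a b c d e. pentagon a b c d e")
  case True
  then show ?thesis
    using pentagon_large_bicomplete by blast
next
  case False
  define N where "N x = {y. R x y}" for x
  have N_W: "N x \<subseteq> W" for x
    using in_W2 by (auto simp: N_def)
  have fin: "finite (N x)" for x
    using N_W finite_W finite_subset by blast
  have fin_image: "finite ((\<lambda>x. card (N x)) ` W)" and "(\<lambda>x. card (N x)) ` W \<noteq> {}"
    using finite_W v by (auto simp: isolated_def)
  then have "Max ((\<lambda>x. card (N x)) ` W) \<in> (\<lambda>x. card (N x)) ` W"
    by (rule Max_in)
  then obtain x where x: "x \<in> W" "card (N x) = Max ((\<lambda>x. card (N x)) ` W)"
    by auto
  have max: "card (N y) \<le> card (N x)" if "y \<in> W" for y
    unfolding x(2) using that fin_image by simp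
  have no_edge: "\<not> R y z" if yz_N: "y \<notin> N x" "z \<notin> N x" for y z
  proof
    assume yz: "R y z"
    \<comment> \<open>Otherwise \<open>y\<close> would have larger degree than \<open>x\<close>,
      because of the extra neighbour \<open>z\<close>.\<close>
    have not_subset: "\<not> N x \<subseteq> N y" if "R y z" "z \<notin> N x" for y z
    proof
      assume "N x \<subseteq> N y"
      then have "N x \<subset> N y"
        using that by (auto simp: N_def)
      then have "card (N x) < card (N y)"
        using fin by (simp add: psubset_card_mono)
      then show False
        using max[of y] in_W[OF that(1)] by simp
    qed
    obtain u where u: "R x u" "\<not> R y u"
      using not_subset[OF yz yz_N(2)] by (auto simp: N_def)
    obtain w where w: "R x w" "\<not> R z w"
      using not_subset[OF sym[OF yz] yz_N(1)] by (auto simp: N_def)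
    \<comment> \<open>The edges \<open>x u\<close> and \<open>y z\<close> cannot induce
      \<open>2K2\<close>, and only \<open>u z\<close> is left to join them; similarly for
      \<open>x w\<close> and \<open>y w\<close>.\<close>
    have "R u z" "R y w"
      using two_K2_free[OF u(1) yz] two_K2_free[OF w(1) yz] u w yz_N sym unfolding N_def by blast+
    then have "pentagon x u z y w"
      using u w yz sym by (auto simp: pentagon_def)
    then show False
      using False by blast
  qed
  have "bicomplete (W - N x)"
    using no_edge by (auto simp: bicomplete_def)
  moreover have "bicomplete (insert v (N x))"
    using v N_W triangle_free sym unfolding bicomplete_def N_def isolated_def by blast
  \<comment> \<open>The isolated vertex \<open>v\<close> is counted in both parts, which makes the
    inequality strict.\<close>
  moreover have "card (W - N x) + card (insert v (N x)) = card W + 1"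
  proof -
    have "v \<notin> N x"
      using v sym by (auto simp: N_def isolated_def)
    then show ?thesis
      using fin[of x] N_W[of x] finite_W card_mono[OF finite_W N_W[of x]]
      by (simp add: card_Diff_subset)
  qed
  then have "card W < 2 * card (W - N x) \<or> card W < 2 * card (insert v (N x))"
    by linarith
  ultimately show ?thesis
    by blast
qed

lemma sym_iff: "R x y \<longleftrightarrow> R y x"
  using sym by blast

lemma irrefl: "\<not> R x x"
  using triangle_free by blast

text \<open>In a triangle-free graph these are the triples not spanning exactly one edge, the
  complement of the two-graph of \<open>R\<close>.\<close>

definition triples :: "'a set set" where
  "triples = {e \<in> [W]\<^bsup>3\<^esup>. bicomplete e}"

lemma triples_subset: "triples \<subseteq> [W]\<^bsup>3\<^esup>"
  by (auto simp: triples_def)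

lemma triples_iff:
  assumes "{a, b, c} \<subseteq> W" "distinct [a, b, c]"
  shows "{a, b, c} \<in> triples \<longleftrightarrow>
    (R a b \<longrightarrow> R a c \<or> R b c) \<and> (R a c \<longrightarrow> R a b \<or> R b c) \<and> (R b c \<longrightarrow> R a b \<or> R a c)"
proof -
  have "{a, b, c} \<in> [W]\<^bsup>3\<^esup>"
    using assms by (auto simp: nsets_def)
  then show ?thesis
    using assms unfolding triples_def bicomplete_def
    by (simp add: irrefl sym_iff[of b a] sym_iff[of c a] sym_iff[of c b]) blast
qed

text \<open>Triples with an odd number of graph edges come in even number on four vertices; without
  triangles these are the missing triples. All four are missing only for an induced
  \<open>2K2\<close>.\<close>

lemma Q_free_triples: "Q_free {(4, 0), (4, 1), (4, 3)} W triples"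
proof (subst Q_free_four_iff[OF triples_subset], intro ballI impI)
  fix a b c d
  assume "a \<in> W" "b \<in> W" "c \<in> W" "d \<in> W" and dist: "distinct [a, b, c, d]"
  then have iffs:
    "{a, b, c} \<in> triples \<longleftrightarrow>
      (R a b \<longrightarrow> R a c \<or> R b c) \<and> (R a c \<longrightarrow> R a b \<or> R b c) \<and> (R b c \<longrightarrow> R a b \<or> R a c)"
    "{a, b, d} \<in> triples \<longleftrightarrow>
      (R a b \<longrightarrow> R a d \<or> R b d) \<and> (R a d \<longrightarrow> R a b \<or> R b d) \<and> (R b d \<longrightarrow> R a b \<or> R a d)"
    "{a, c, d} \<in> triples \<longleftrightarrow>
      (R a c \<longrightarrow> R a d \<or> R c d) \<and> (R a d \<longrightarrow> R a c \<or> R c d) \<and> (R c d \<longrightarrow> R a c \<or> R a d)"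
    "{b, c, d} \<in> triples \<longleftrightarrow>
      (R b c \<longrightarrow> R b d \<or> R c d) \<and> (R b d \<longrightarrow> R b c \<or> R c d) \<and> (R c d \<longrightarrow> R b c \<or> R b d)"
    by (intro triples_iff; simp)+
  show "of_bool ({a, b, c} \<in> triples) + of_bool ({a, b, d} \<in> triples) + of_bool ({a, c, d} \<in> triples)
      + of_bool ({b, c, d} \<in> triples) \<notin> {0, 1, 3 :: nat}"
    unfolding iffs
    using triangle_free[of a b c] triangle_free[of a b d] triangle_free[of a c d] triangle_free[of b c d]
      two_K2_free[of a b c d] two_K2_free[of a c b d] two_K2_free[of a d b c] sym_iff[of c b] sym_iff[of d c] sym_iff[of d b]
    by (cases "R a b"; cases "R a c"; cases "R a d"; cases "R b c"; cases "R b d"; cases "R c d"; simp)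
qed

lemma bicomplete_if_clique:
  assumes "S \<subseteq> W" "[S]\<^bsup>3\<^esup> \<subseteq> triples"
  shows "bicomplete S"
  unfolding bicomplete_def
proof (intro conjI ballI impI)
  fix x y z
  assume xyz: "x \<in> S" "y \<in> S" "z \<in> S" and "R x y"
  show "R x z \<or> R y z"
  proof (cases "distinct [x, y, z]")
    case True
    then have "{x, y, z} \<in> triples"
      using assms(2) xyz by (simp add: nsets3_subset_iff)
    then show ?thesis
      using \<open>R x y\<close> by (auto simp: triples_def bicomplete_def)
  next
    case False
    then show ?thesis
      using \<open>R x y\<close> irrefl[of x] sym[of x y] by (cases "x = z"; cases "y = z") simp_all
  qed
qed (fact assms(1))

end

section \<open>Hypergraphs whose four-sets span two or four edges\<close>

text \<open>The link graph of a vertex \<open>v\<close> in the complementary hypergraph, with \<open>v\<close> added as an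
  isolated vertex, determines the hypergraph.\<close>
lemma large_clique_of_two_or_four:
  assumes G: "three_graph V E" and Q: "Q_free {(4, 0), (4, 1), (4, 3)} V E" and "V \<noteq> {}"
  shows "\<exists>S. homogeneous V E S \<and> (card V < 2 * card S \<or> 6 dvd card V \<and> card V = 2 * card S)"
proof -
  obtain v where v: "v \<in> V"
    using assms(3) by blast
  define T where "T a b c \<longleftrightarrow> {a, b, c} \<in> E" for a b c
  have T_swap: "T a b c \<longleftrightarrow> T b a c" "T a b c \<longleftrightarrow> T a c b" for a b c
    unfolding T_def by (simp_all add: insert_commute)
  have quad: "of_bool (T a b c) + of_bool (T a b d) + of_bool (T a c d) + of_bool (T b c d)
      \<notin> {0, 1, 3 :: nat}"
    if "{a, b, c, d} \<subseteq> V" "distinct [a, b, c, d]" for a b c d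
    using Q that G unfolding T_def three_graph_def by (subst (asm) Q_free_four_iff) auto
  define R where "R x y \<longleftrightarrow> {x, y} \<subseteq> V \<and> distinct [v, x, y] \<and> \<not> T v x y" for x y
  have R_sym: "R x y \<Longrightarrow> R y x" for x y
    unfolding R_def using T_swap by auto
  have tri: "\<not> R x z" if "R x y" "R y z" for x y z
    using quad[of v x y z] that v unfolding R_def by (cases "T x y z") auto
  \<comment> \<open>If \<open>{x, y, z}\<close> were an edge, \<open>{v, x, y, z}\<close> would span
    exactly three edges.\<close>
  have nonedge: "\<not> T x y z" if "R x y" "\<not> R x z" "\<not> R y z" "z \<in> V" "distinct [x, y, z]" for x y z
  proof (cases "z = v")
    case True
    then show ?thesis
      using that(1) T_swap(1)[of v x y] T_swap(2)[of x v y] unfolding R_def by simp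
  next
    case False
    then show ?thesis
      using quad[of v x y z] that v unfolding R_def by auto
  qed
  \<comment> \<open>An induced \<open>2K2\<close> would make \<open>{x, y, z, w}\<close> span no
    edge at all.\<close>
  have two: "R x z \<or> R x w \<or> R y z \<or> R y w" if xy: "R x y" and zw: "R z w" for x y z w
  proof (rule ccontr)
    assume no: "\<not> ?thesis"
    then have no': "\<not> R z x" "\<not> R w x" "\<not> R z y" "\<not> R w y"
      using R_sym by blast+
    have "x \<noteq> z" "x \<noteq> w" "y \<noteq> z" "y \<noteq> w"
      using no no' zw by auto
    then have dist: "distinct [x, y, z, w]" and V: "{x, y, z, w} \<subseteq> V"
      using xy zw unfolding R_def by auto
    have "\<not> T x y z" "\<not> T x y w" "\<not> T z w x" "\<not> T z w y"
      using nonedge[OF xy, of z] nonedge[OF xy, of w] nonedge[OF zw, of x] nonedge[OF zw, of y] no no' dist V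
      by auto
    then show False
      using quad[OF V dist] T_swap(1)[of x z w] T_swap(2)[of z x w] T_swap(1)[of y z w] T_swap(2)[of z y w]
      by simp
  qed
  interpret triangle_2K2_free_graph V R
  proof
    show "finite V"
      using G by (simp add: three_graph_def)
    show "x \<in> V" if "R x y" for x y
      using that by (auto simp: R_def)
  qed (fact R_sym tri two)+
  have "v \<in> isolated"
    using v by (auto simp: isolated_def R_def)
  then obtain S where S: "bicomplete S" "card V < 2 * card S \<or> 6 dvd card V \<and> card V = 2 * card S"
    using large_bicomplete by blast
  have edge: "T x y z" if "x \<in> S" "y \<in> S" "z \<in> S" "distinct [x, y, z]" for x y z
  proof (rule ccontr)
    assume no: "\<not> T x y z"
    have bi: "R a b \<Longrightarrow> R a c \<or> R b c" if "a \<in> S" "b \<in> S" "c \<in> S" for a b c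
      using S(1) that unfolding bicomplete_def by blast
    have SV: "{x, y, z} \<subseteq> V"
      using S(1) that unfolding bicomplete_def by blast
    have nov: "\<not> R v u" "\<not> R u v" for u
      by (auto simp: R_def)
    consider "x = v" | "y = v" | "z = v" | "v \<notin> {x, y, z}"
      by blast
    then show False
    proof cases
      case 1
      then have "R y z"
        using no SV that by (auto simp: R_def)
      then show ?thesis
        using bi[of y z x] that nov 1 by simp
    next
      case 2
      then have "R x z"
        using no SV that T_swap(1)[of v x z] by (auto simp: R_def)
      then show ?thesis
        using bi[of x z y] that nov 2 by simp
    next
      case 3
      then have "R x y"
        using no SV that T_swap(1)[of v x y] T_swap(2)[of x v y] by (auto simp: R_def)
      then show ?thesis
        using bi[of x y z] that nov 3 by simp
    next
      case 4
      then have "R x y \<longleftrightarrow> \<not> T v x y" "R x z \<longleftrightarrow> \<not> T v x z" "R y z \<longleftrightarrow> \<not> T v y z"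
        using SV that by (auto simp: R_def)
      moreover have "R x y \<Longrightarrow> R x z \<or> R y z" "R x z \<Longrightarrow> R x y \<or> R y z" "R y z \<Longrightarrow> R x y \<or> R x z"
        using bi[of x y z] bi[of x z y] bi[of y z x] R_sym that by blast+
      \<comment> \<open>As \<open>{x, y, z}\<close> is a non-edge, this count must be two, so
        exactly one of the three pairs is related by \<open>R\<close>, against
        bicompleteness.\<close>
      moreover have "of_bool (T v x y) + of_bool (T v x z) + of_bool (T v y z) + of_bool (T x y z)
          \<notin> {0, 1, 3 :: nat}"
        using SV v that 4 by (intro quad) auto
      ultimately show ?thesis
        using no by (cases "R x y"; cases "R x z"; cases "R y z"; simp)
    qed
  qed
  have "homogeneous V E S"
    using S(1) edge unfolding homogeneous_def nsets3_subset_iff bicomplete_def T_def by blast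
  then show ?thesis
    using S(2) by blast
qed

section \<open>The blown-up pentagon\<close>

text \<open>The pentagon \<open>0-1-3-4-5\<close> with isolated vertex \<open>2\<close>. This labelling gives the remainder
  classes that are larger by one, namely \<open>0, \<dots>, n mod 6 - 1\<close>, no bicomplete triple among
  the first three.\<close>
definition pentagon_edges :: "(nat \<times> nat) set" where
  "pentagon_edges = {(0, 1), (1, 0), (1, 3), (3, 1), (3, 4), (4, 3), (4, 5), (5, 4), (5, 0), (0, 5)}"

definition blowup :: "nat \<Rightarrow> nat \<Rightarrow> nat \<Rightarrow> bool" where
  "blowup n x y \<longleftrightarrow> x < n \<and> y < n \<and> (x mod 6, y mod 6) \<in> pentagon_edges"

text \<open>Adjacency depends only on residues, so the axioms reduce to finite checks on the
  pentagon.\<close>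

lemma triangle_2K2_free_blowup: "triangle_2K2_free_graph {..<n} (blowup n)"
proof
  have sym: "\<forall>(i, j) \<in> pentagon_edges. (j, i) \<in> pentagon_edges"
    unfolding pentagon_edges_def by code_simp
  have tri: "\<forall>(i, j) \<in> pentagon_edges. \<forall>(k, l) \<in> pentagon_edges. j = k \<longrightarrow> (i, l) \<notin> pentagon_edges"
    unfolding pentagon_edges_def by code_simp
  have two: "\<forall>(i, j) \<in> pentagon_edges. \<forall>(k, l) \<in> pentagon_edges. (i, k) \<in> pentagon_edges \<or>
      (i, l) \<in> pentagon_edges \<or> (j, k) \<in> pentagon_edges \<or> (j, l) \<in> pentagon_edges"
    unfolding pentagon_edges_def by code_simp
  fix x y z w
  show "blowup n y x" if "blowup n x y"
    using that sym unfolding blowup_def by fast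
  show "\<not> blowup n x z" if "blowup n x y" "blowup n y z"
    using that tri unfolding blowup_def by fast
  show "blowup n x z \<or> blowup n x w \<or> blowup n y z \<or> blowup n y w" if "blowup n x y" "blowup n z w"
    using that two unfolding blowup_def by fast
qed (auto simp: blowup_def)

lemma card_residue_class_le:
  assumes "t < 6"
  shows "card {x \<in> {..<n}. x mod 6 = t} \<le> (n + 5 - t) div 6"
proof -
  have "card {x \<in> {..<n}. x mod 6 = t} \<le> card {..<(n + 5 - t) div 6}"
  proof (rule card_inj_on_le[of "\<lambda>x. x div 6"])
    show "inj_on (\<lambda>x. x div 6) {x \<in> {..<n}. x mod 6 = t}"
      by (intro inj_onI) (metis (mono_tags, lifting) div_mult_mod_eq mem_Collect_eq)
    have "x div 6 < (n + 5 - x mod 6) div 6" if "x < n" for x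
    proof -
      have "6 * (x div 6) + 6 + x mod 6 \<le> n + 5"
        using that mult_div_mod_eq[of 6 x] by linarith
      then have "6 * (x div 6) + 6 \<le> n + 5 - x mod 6"
        by (rule add_le_imp_le_diff)
      then have "x div 6 + 1 \<le> (n + 5 - x mod 6) div 6"
        by (simp add: less_eq_div_iff_mult_less_eq mult.commute)
      then show ?thesis
        by simp
    qed
    then show "(\<lambda>x. x div 6) ` {x \<in> {..<n}. x mod 6 = t} \<subseteq> {..<(n + 5 - t) div 6}"
      by auto
  qed simp
  then show ?thesis
    by simp
qed

lemma card_bicomplete_blowup_le:
  fixes n :: nat
  assumes "triangle_2K2_free_graph.bicomplete {..<n} (blowup n) S"
  shows "card S \<le> (if n mod 6 = 0 then n div 2 else n div 2 + 1)"
proof -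
  interpret triangle_2K2_free_graph "{..<n}" "blowup n"
    by (rule triangle_2K2_free_blowup)
  define f where "f t = card {x \<in> S. x mod 6 = t}" for t :: nat
  have S: "S \<subseteq> {..<n}"
    using assms by (simp add: bicomplete_def)
  then have fin: "finite S"
    using finite_subset by blast
  have "card S = (\<Sum>t<6. f t)"
  proof -
    have "S = (\<Union>t<6. {x \<in> S. x mod 6 = t})"
      by auto
    then have "card S = card (\<Union>t<6. {x \<in> S. x mod 6 = t})"
      by simp
    also have "\<dots> = (\<Sum>t<6. f t)"
      unfolding f_def using fin by (intro card_UN_disjoint) auto
    finally show ?thesis .
  qed
  then have total: "card S = f 0 + f 1 + f 2 + f 3 + f 4 + f 5"
    by (simp add: eval_nat_numeral)
  have le: "f t \<le> (n + 5 - t) div 6" if "t < 6" for t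
  proof -
    have "f t \<le> card {x \<in> {..<n}. x mod 6 = t}"
      unfolding f_def using S by (intro card_mono) auto
    then show ?thesis
      using card_residue_class_le[OF that, of n] by linarith
  qed
  have zero: "f i = 0 \<or> f j = 0 \<or> f k = 0"
    if "(i, j) \<in> pentagon_edges" "(i, k) \<notin> pentagon_edges" "(j, k) \<notin> pentagon_edges" for i j k
  proof (rule ccontr)
    assume "\<not> ?thesis"
    then have "{x \<in> S. x mod 6 = i} \<noteq> {}" "{x \<in> S. x mod 6 = j} \<noteq> {}" "{x \<in> S. x mod 6 = k} \<noteq> {}"
      unfolding f_def by (metis card.empty)+
    then obtain x y z where "x \<in> S" "y \<in> S" "z \<in> S" "x mod 6 = i" "y mod 6 = j" "z mod 6 = k"
      by blast
    then show False
      using assms that S unfolding bicomplete_def blowup_def by blast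
  qed
  \<comment> \<open>Each pentagon edge is paired with the isolated class \<open>2\<close> and with
    the opposite pentagon vertex, giving ten forbidden triples.\<close>
  have zeros:
    "f 0 = 0 \<or> f 1 = 0 \<or> f 2 = 0" "f 1 = 0 \<or> f 3 = 0 \<or> f 2 = 0" "f 3 = 0 \<or> f 4 = 0 \<or> f 2 = 0"
    "f 4 = 0 \<or> f 5 = 0 \<or> f 2 = 0" "f 5 = 0 \<or> f 0 = 0 \<or> f 2 = 0" "f 0 = 0 \<or> f 1 = 0 \<or> f 4 = 0"
    "f 1 = 0 \<or> f 3 = 0 \<or> f 5 = 0" "f 3 = 0 \<or> f 4 = 0 \<or> f 0 = 0" "f 4 = 0 \<or> f 5 = 0 \<or> f 1 = 0"
    "f 5 = 0 \<or> f 0 = 0 \<or> f 3 = 0"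
    by (rule zero; simp add: pentagon_edges_def)+
  define q r where "q = n div 6" and "r = n mod 6"
  have n: "n = 6 * q + r" and r: "r < 6"
    by (auto simp: q_def r_def)
  have bound: "f t \<le> q + of_bool (t < r)" if "t < 6" for t
  proof -
    have "(n + 5 - t) div 6 \<le> q + of_bool (t < r)"
      using that r unfolding n by (cases "t < r") auto
    then show ?thesis
      using le[OF that] by linarith
  qed
  have bounds: "f 0 \<le> q + of_bool (0 < r)" "f 1 \<le> q + of_bool (1 < r)" "f 2 \<le> q + of_bool (2 < r)"
    "f 3 \<le> q + of_bool (3 < r)" "f 4 \<le> q + of_bool (4 < r)" "f 5 \<le> q"
    using bound[of 0] bound[of 1] bound[of 2] bound[of 3] bound[of 4] bound[of 5] r by simp_all
  have half: "n div 2 = 3 * q + r div 2"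
    unfolding n by presburger
  have "r = 0 \<or> r = 1 \<or> r = 2 \<or> r = 3 \<or> r = 4 \<or> r = 5"
    using r by linarith
  \<comment> \<open>The ten triples of classes in \<open>zeros\<close> meet pairwise, and every set meeting all of them
    contains one of them.\<close>
  moreover have "f 0 = 0 \<and> f 1 = 0 \<and> f 2 = 0 \<or> f 1 = 0 \<and> f 3 = 0 \<and> f 2 = 0 \<or> f 3 = 0 \<and> f 4 = 0 \<and> f 2 = 0 \<or>
    f 4 = 0 \<and> f 5 = 0 \<and> f 2 = 0 \<or> f 5 = 0 \<and> f 0 = 0 \<and> f 2 = 0 \<or> f 0 = 0 \<and> f 1 = 0 \<and> f 4 = 0 \<or>
    f 1 = 0 \<and> f 3 = 0 \<and> f 5 = 0 \<or> f 3 = 0 \<and> f 4 = 0 \<and> f 0 = 0 \<or> f 4 = 0 \<and> f 5 = 0 \<and> f 1 = 0 \<or>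
    f 5 = 0 \<and> f 0 = 0 \<and> f 3 = 0"
    using zeros by argo
  \<comment> \<open>At most three classes remain, with at most \<open>min r 3\<close> extra
    vertices. This exceeds \<open>r div 2 + 1\<close> only for \<open>r = 3\<close> with remaining
    classes \<open>0\<close>, \<open>1\<close>, \<open>2\<close>, but \<open>3\<close>,
    \<open>4\<close>, \<open>5\<close> is not among the ten vanishing triples.\<close>
  ultimately have "f 0 + f 1 + f 2 + f 3 + f 4 + f 5 \<le> (if r = 0 then 3 * q else 3 * q + r div 2 + 1)"
    using bounds by (elim disjE; simp)
  then show ?thesis
    unfolding total half r_def[symmetric] by (simp split: if_splits)
qed

lemma h3_two_or_four:
  assumes "n \<ge> 4"
  shows "h3 n {(4, 0), (4, 1), (4, 3)} = (if n mod 6 = 0 then n div 2 else n div 2 + 1)"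
    (is "_ = ?k")
proof -
  interpret triangle_2K2_free_graph "{..<n}" "blowup n"
    by (rule triangle_2K2_free_blowup)
  show ?thesis
  proof (rule h3_eqI)
    show "three_graph {..<n} triples"
      using triples_subset by (simp add: three_graph_def)
    show "Q_free {(4, 0), (4, 1), (4, 3)} {..<n} triples"
      by (rule Q_free_triples)
    show "card S \<le> ?k" if S: "homogeneous {..<n} triples S" for S
    proof (cases "[S]\<^bsup>3\<^esup> \<subseteq> triples")
      case True
      then show ?thesis
        using S by (intro card_bicomplete_blowup_le bicomplete_if_clique) (auto simp: homogeneous_def)
    next
      case False
      then have co: "[S]\<^bsup>3\<^esup> \<inter> triples = {}" and SV: "S \<subseteq> {..<n}"
        using S by (auto simp: homogeneous_def)
      \<comment> \<open>A coclique on four vertices would be a four-set spanning no edge.\<close>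
      have "card S < 4"
      proof (rule ccontr)
        assume "\<not> card S < 4"
        then obtain U where U: "U \<subseteq> S" "card U = 4"
          using obtain_subset_with_card_n[of 4 S] by auto
        then have "U \<in> [{..<n}]\<^bsup>4\<^esup>"
          using SV by (auto simp: nsets_def intro: card_ge_0_finite)
        moreover have "e \<notin> triples" if "e \<subseteq> U" for e
        proof
          assume e: "e \<in> triples"
          then have "e \<in> [{..<n}]\<^bsup>3\<^esup>"
            using triples_subset by blast
          moreover have "e \<subseteq> S"
            using that U(1) by (rule subset_trans)
          ultimately have "e \<in> [S]\<^bsup>3\<^esup>"
            by (simp add: nsets_def)
          then show False
            using co e by blast
        qed
        then have "{e \<in> triples. e \<subseteq> U} = {}"
          by blast
        then have "card {e \<in> triples. e \<subseteq> U} = 0"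
          by (simp only: card.empty)
        ultimately show False
          using bspec[OF Q_free_triples[unfolded Q_free_def] insertI1, unfolded split_conv] by blast
      qed
      moreover have "n mod 6 = 0 \<Longrightarrow> 3 \<le> n div 2" "3 \<le> n div 2 + 1"
        using assms by presburger+
      ultimately show ?thesis
        by auto
    qed
    show "\<exists>S. homogeneous V E S \<and> ?k \<le> card S"
      if H: "three_graph V E" "card V = n" "Q_free {(4, 0), (4, 1), (4, 3)} V E" for V :: "nat set" and E
    proof -
      have "V \<noteq> {}"
        using H(2) assms by auto
      then obtain S where "homogeneous V E S" "card V < 2 * card S \<or> 6 dvd card V \<and> card V = 2 * card S"
        using large_clique_of_two_or_four[OF H(1,3)] by blast
      then show ?thesis
        using H(2) by (intro exI[of _ S]) (auto simp: dvd_eq_mod_eq_0)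
    qed
  qed simp
qed

theorem theorem1p7:
  fixes n :: nat
  assumes "n \<ge> 4"
  shows "h3 n {(4, 0), (4, 2), (4, 3)} = n - 1 \<and>
    real (h3 n {(4, 0), (4, 1), (4, 3)}) =
      (if n mod 6 = 0 then real n / 2 else real_of_int \<lceil>(real n + 1) / 2\<rceil>)"
proof -
  have "n = 2 * (n div 2) \<or> n = 2 * (n div 2) + 1"
    by presburger
  then have "real n = 2 * real (n div 2) \<or> real n = 2 * real (n div 2) + 1"
    by (metis of_nat_1 of_nat_add of_nat_mult of_nat_numeral)
  \<comment> \<open>For odd \<open>n\<close> the quotient is already this integer; for even
    \<open>n\<close> it lies one half below.\<close>
  then have "\<lceil>(real n + 1) / 2\<rceil> = int (n div 2 + 1)"
    by (intro ceiling_unique) auto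
  then have up: "real_of_int \<lceil>(real n + 1) / 2\<rceil> = real (n div 2 + 1)"
    by (simp only: of_int_of_nat_eq)
  have half: "real (n div 2) = real n / 2" if "n mod 6 = 0"
  proof -
    have "2 dvd n"
      using that by presburger
    then show ?thesis
      by (simp add: real_of_nat_div)
  qed
  show ?thesis
    unfolding h3_one_or_four[OF assms] h3_two_or_four[OF assms] up
    using half by (cases "n mod 6 = 0") (simp_all only: if_True if_False simp_thms)
qed

end
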